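(* Let $G$ be a connected graph. The following are equivalent: (1) $G$ has no choke points; (2) $G$ satisfies the pairwise edge-disjoint path property; (3) $G$ is a tree or a cycle.
   Context: A path has no repeated vertices; $\mathcal{P}(u,v)$ is the set of paths from $u$ to $v$ in $G$. $G$ has the pairwise edge-disjoint path property if for any distinct vertices $u,v$ and any two distinct $u,v$-paths $P_1,P_2$, $E(P_1)\cap E(P_2)=\emptyset$. A star $S_k$ is a tree on $k+1$ vertices consisting of one vertex (the internal vertex) adjacent to all $k$ others. For $u,v\in V(G)$, let $F=\bigcup_{P\in\mathcal{P}(u,v)}P$ (the subgraph consisting of all vertices and edges of $u,v$-paths); if $F$ contains a star $S_k$ with $k\ge 3$ as a subgraph, its internal vertex is called a choke point of $u$ and $v$. $G$ has a choke point if some vertex is a choke point of some pair $u,v$. *)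

theory Defs
  imports Main
begin

text \<open>Undirected simple graphs, not assumed finite: an edge is an unordered pair of distinct
  vertices.\<close>

record 'a ugraph =
  verts :: "'a set"
  edges :: "'a set set"

definition simple_graph :: "'a ugraph \<Rightarrow> bool" where
  "simple_graph G \<longleftrightarrow> (\<forall>e \<in> edges G. e \<subseteq> verts G \<and> card e = 2)"

definition subgraph :: "'a ugraph \<Rightarrow> 'a ugraph \<Rightarrow> bool" where
  "subgraph H G \<longleftrightarrow> simple_graph H \<and> verts H \<subseteq> verts G \<and> edges H \<subseteq> edges G"

fun path_edges :: "'a list \<Rightarrow> 'a set set" where
  "path_edges [] = {}"
| "path_edges [x] = {}"
| "path_edges (x # y # xs) = insert {x, y} (path_edges (y # xs))"

text \<open>A path from \<open>u\<close> to \<open>v\<close> is given by its vertex list. For fixed end vertices, distinct lists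
  give distinct subgraphs \<open>path_graph p\<close>.\<close>

definition paths :: "'a ugraph \<Rightarrow> 'a \<Rightarrow> 'a \<Rightarrow> 'a list set" where
  "paths G u v = {p. p \<noteq> [] \<and> hd p = u \<and> last p = v \<and> distinct p
     \<and> set p \<subseteq> verts G \<and> path_edges p \<subseteq> edges G}"

definition path_graph :: "'a list \<Rightarrow> 'a ugraph" where
  "path_graph p = \<lparr>verts = set p, edges = path_edges p\<rparr>"

definition connected_graph :: "'a ugraph \<Rightarrow> bool" where
  "connected_graph G \<longleftrightarrow>
     verts G \<noteq> {} \<and> (\<forall>u \<in> verts G. \<forall>v \<in> verts G. paths G u v \<noteq> {})"

definition is_cycle :: "'a ugraph \<Rightarrow> bool" where
  "is_cycle G \<longleftrightarrow> (\<exists>p. distinct p \<and> 3 \<le> length p \<and> verts G = set p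
     \<and> edges G = insert {last p, hd p} (path_edges p))"

definition is_tree :: "'a ugraph \<Rightarrow> bool" where
  "is_tree G \<longleftrightarrow> simple_graph G \<and> connected_graph G \<and> \<not> (\<exists>C. subgraph C G \<and> is_cycle C)"

text \<open>\<open>is_star k c S\<close>: the graph \<open>S\<close> is a star with \<open>k\<close> leaves and internal vertex \<open>c\<close>.\<close>

definition is_star :: "nat \<Rightarrow> 'a \<Rightarrow> 'a ugraph \<Rightarrow> bool" where
  "is_star k c S \<longleftrightarrow> is_tree S \<and> card (verts S) = k + 1 \<and> c \<in> verts S
     \<and> (\<forall>w \<in> verts S - {c}. {c, w} \<in> edges S)"

definition paths_union :: "'a ugraph \<Rightarrow> 'a \<Rightarrow> 'a \<Rightarrow> 'a ugraph" where
  "paths_union G u v =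
     \<lparr>verts = (\<Union>p \<in> paths G u v. verts (path_graph p)),
      edges = (\<Union>p \<in> paths G u v. edges (path_graph p))\<rparr>"

definition choke_point :: "'a ugraph \<Rightarrow> 'a \<Rightarrow> 'a \<Rightarrow> 'a \<Rightarrow> bool" where
  "choke_point G u v c \<longleftrightarrow>
     (\<exists>k S. 3 \<le> k \<and> is_star k c S \<and> subgraph S (paths_union G u v))"

definition has_choke_point :: "'a ugraph \<Rightarrow> bool" where
  "has_choke_point G \<longleftrightarrow> (\<exists>u \<in> verts G. \<exists>v \<in> verts G. \<exists>c. choke_point G u v c)"

definition edge_disjoint_path_property :: "'a ugraph \<Rightarrow> bool" where
  "edge_disjoint_path_property G \<longleftrightarrow>
     (\<forall>u \<in> verts G. \<forall>v \<in> verts G. u \<noteq> v \<longrightarrow>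
        (\<forall>p \<in> paths G u v. \<forall>q \<in> paths G u v. p \<noteq> q \<longrightarrow>
           edges (path_graph p) \<inter> edges (path_graph q) = {}))"

end

theory Submission imports Defs begin

text \<open>A connected graph that is neither a tree nor a cycle contains a cycle together with either a
  chord or an edge leaving it; in both cases the two arcs of the cycle, combined with the extra
  edge, give paths exhibiting a choke point and two paths sharing an edge. Conversely, paths in a
  tree are unique, whereas in a graph of maximum degree two a path is determined by any of its
  edges and its end vertices; in both cases a union of paths has no vertex of degree three.\<close>

section \<open>Edge sets of paths and cycles\<close>

text \<open>The edge set in \<open>is_cycle\<close>, named so that it can be rotated. No length
  bound is built in: a singleton list gives \<open>{{x}}\<close>, and the value at \<open>[]\<close>
  depends on the unspecified \<open>hd []\<close> and \<open>last []\<close>.\<close>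

definition cycle_edges :: "'a list \<Rightarrow> 'a set set" where
  "cycle_edges p = insert {last p, hd p} (path_edges p)"

text \<open>Maximum degree at most two as a pigeonhole condition on neighbours. It passes to subsets
  of the edge set and avoids cardinalities.\<close>

definition degree_le_2 :: "'a set set \<Rightarrow> bool" where
  "degree_le_2 E \<longleftrightarrow> (\<forall>c x y z. {c, x} \<in> E \<longrightarrow> {c, y} \<in> E \<longrightarrow> {c, z} \<in> E \<longrightarrow>
     x = y \<or> x = z \<or> y = z)"

lemma path_edges_Cons:
  "path_edges (x # xs) = (if xs = [] then {} else insert {x, hd xs} (path_edges xs))"
  by (cases xs) auto

lemma path_edges_append:
  "path_edges (xs @ ys) = path_edges xs \<union> path_edges ys \<union>
     (if xs = [] \<or> ys = [] then {} else {{last xs, hd ys}})"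
  by (induction xs) (auto simp: path_edges_Cons)

lemma path_edges_rev: "path_edges (rev xs) = path_edges xs"
  by (induction xs) (auto simp: path_edges_Cons path_edges_append last_rev insert_commute)

lemma path_edges_subset: "e \<in> path_edges p \<Longrightarrow> e \<subseteq> set p"
  by (induction p rule: path_edges.induct) auto

lemma path_edges_split:
  "e \<in> path_edges p \<Longrightarrow> \<exists>xs x y ys. p = xs @ x # y # ys \<and> e = {x, y}"
proof (induction p rule: path_edges.induct)
  case (3 x y zs)
  show ?case
  proof (cases "e = {x, y}")
    case True
    then show ?thesis by (metis append_Nil)
  next
    case False
    then obtain xs a b ys where "y # zs = xs @ a # b # ys \<and> e = {a, b}"
      using 3 by auto
    then show ?thesis by (metis append_Cons)
  qed
qed auto

text \<open>The closing edge of one list is the edge joining the two parts in the other.\<close>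

lemma cycle_edges_rotate: "cycle_edges (xs @ ys) = cycle_edges (ys @ xs)"
  by (auto simp: cycle_edges_def path_edges_append insert_commute)

text \<open>Lets any vertex of a cycle be treated as the first one, where its neighbours are easy to
  read off.\<close>

lemma rotate_to_head:
  assumes "x \<in> set p" "distinct p"
  obtains r where "distinct (x # r)" "set (x # r) = set p" "length (x # r) = length p"
    "cycle_edges (x # r) = cycle_edges p"
proof -
  obtain as bs where p: "p = as @ x # bs"
    using assms(1) by (meson split_list)
  show ?thesis
    using that[of "bs @ as"] assms(2) p cycle_edges_rotate[of as "x # bs"] by auto
qed

text \<open>No edge of \<open>path_edges r\<close> contains \<open>c\<close>, so only the first edge
  and the closing edge remain.\<close>

lemma neighbour_in_cycle:
  assumes "distinct (c # r)" "{c, w} \<in> cycle_edges (c # r)"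
  shows "r = [] \<or> w = hd r \<or> w = last r"
proof (cases "r = []")
  case False
  have "{c, w} \<notin> path_edges r"
    using path_edges_subset[of "{c, w}" r] assms(1) by auto
  then show ?thesis
    using assms False by (auto simp: cycle_edges_def path_edges_Cons doubleton_eq_iff)
qed auto

lemma cycle_edges_subset: "p \<noteq> [] \<Longrightarrow> e \<in> cycle_edges p \<Longrightarrow> e \<subseteq> set p"
  using path_edges_subset[of e p] by (auto simp: cycle_edges_def)

lemma degree_le_2_cycle_edges:
  assumes "distinct p" "p \<noteq> []"
  shows "degree_le_2 (cycle_edges p)"
  unfolding degree_le_2_def
proof (intro allI impI)
  fix c x y z
  assume E: "{c, x} \<in> cycle_edges p" "{c, y} \<in> cycle_edges p" "{c, z} \<in> cycle_edges p"
  have "c \<in> set p" using cycle_edges_subset[OF assms(2) E(1)] by auto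
  then obtain r where r: "distinct (c # r)" "cycle_edges (c # r) = cycle_edges p"
    by (rule rotate_to_head[OF _ assms(1)])
  show "x = y \<or> x = z \<or> y = z"
  proof (cases "r = []")
    case True
    then have "cycle_edges p = {{c}}" using r(2) by (auto simp: cycle_edges_def)
    then show ?thesis using E by auto
  next
    case False
    then show ?thesis using E neighbour_in_cycle[OF r(1)] r(2) by metis
  qed
qed

lemma degree_le_2_mono: "degree_le_2 E \<Longrightarrow> F \<subseteq> E \<Longrightarrow> degree_le_2 F"
  unfolding degree_le_2_def by blast

lemma degree_le_2_path_edges: "distinct p \<Longrightarrow> degree_le_2 (path_edges p)"
proof (cases "p = []")
  case True
  then show ?thesis by (simp add: degree_le_2_def)
next
  case False
  assume "distinct p"
  then show ?thesis
    using False degree_le_2_mono[OF degree_le_2_cycle_edges[of p], of "path_edges p"]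
    by (auto simp: cycle_edges_def)
qed

section \<open>Rigidity of paths under maximum degree two\<close>

text \<open>A vertex entered along one edge has at most one other edge to leave by. Hence paths with
  the same first directed edge agree until one of them stops.\<close>

lemma path_continuation_unique:
  assumes "degree_le_2 E"
    and "path_edges (x # y # p) \<subseteq> E" "distinct (x # y # p)"
    and "path_edges (x # y # q) \<subseteq> E" "distinct (x # y # q)"
  shows "\<exists>r. p = q @ r \<or> q = p @ r"
  using assms(2-)
proof (induction p arbitrary: x y q)
  case (Cons a p)
  show ?case
  proof (cases q)
    case (Cons b q')
    have "{y, x} \<in> E" "{y, a} \<in> E" "{y, b} \<in> E"
      using Cons.prems Cons by (auto simp: insert_commute)
    \<comment> \<open>Both differ from \<open>x\<close> by distinctness, and \<open>y\<close> has at
      most two neighbours.\<close>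
    then have "a = b"
      using assms(1) Cons.prems Cons unfolding degree_le_2_def by auto
    then show ?thesis
      using Cons.IH[of y a q'] Cons.prems Cons by auto
  qed auto
qed auto

text \<open>If one continuation were a proper prefix of the other, the common end vertex would occur
  twice on the longer path.\<close>

lemma path_continuation_unique_last:
  assumes "degree_le_2 E"
    and "path_edges (x # y # p) \<subseteq> E" "distinct (x # y # p)"
    and "path_edges (x # y # q) \<subseteq> E" "distinct (x # y # q)"
    and "last (y # p) = last (y # q)"
  shows "p = q"
proof -
  have *: "s = t" if "s = t @ r" "last (y # s) = last (y # t)" "distinct (y # s)" for s t r
  proof (cases "r = []")
    case False
    then have "last (y # s) \<in> set r" using that(1) by simp
    moreover have "last (y # s) \<in> set (y # t)" using that(2) by (metis last_in_set list.distinct(1))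
    ultimately show ?thesis using that by auto
  qed (use that in auto)
  have "distinct (y # p)" "distinct (y # q)" using assms(3,5) by auto
  then show ?thesis
    using path_continuation_unique[OF assms(1-5)] * assms(6) by metis
qed

text \<open>Both paths are split at the common edge. Traversed in the same direction, it forces both
  halves to agree; traversed in opposite directions, it forces an end vertex to lie on both sides of
  the edge.\<close>

lemma degree_le_2_edge_disjoint:
  assumes E: "degree_le_2 E"
    and p: "p \<noteq> []" "path_edges p \<subseteq> E" "distinct p"
    and q: "q \<noteq> []" "path_edges q \<subseteq> E" "distinct q"
    and ends: "hd p = hd q" "last p = last q"
    and e: "e \<in> path_edges p" "e \<in> path_edges q"
  shows "p = q"
proof -
  obtain p1 x y p2 where pp: "p = p1 @ x # y # p2" "e = {x, y}"
    using path_edges_split[OF e(1)] by auto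
  obtain q1 x' y' q2 where qq: "q = q1 @ x' # y' # q2" "e = {x', y'}"
    using path_edges_split[OF e(2)] by auto
  \<comment> \<open>A path \<open>w\<close> through the edge from \<open>a\<close> to
    \<open>b\<close> yields two paths that start with this edge: backwards to \<open>hd w\<close>,
    and forwards along \<open>t\<close>.\<close>
  have pre: "path_edges (b # a # rev s) \<subseteq> E \<and> distinct (b # a # rev s)
      \<and> path_edges (a # b # t) \<subseteq> E \<and> distinct (a # b # t) \<and> last (a # rev s) = hd w"
    if "w = s @ a # b # t" "path_edges w \<subseteq> E" "distinct w" for w s a b t
    using that path_edges_rev[of s]
    by (cases s) (auto simp: path_edges_append path_edges_Cons hd_rev insert_commute split: if_splits)
  note P = pre[OF pp(1) p(2,3)] and Q = pre[OF qq(1) q(2,3)]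
  consider "x' = x" "y' = y" | "x' = y" "y' = x"
    using pp(2) qq(2) by (auto simp: doubleton_eq_iff)
  then show ?thesis
  proof cases
    case 1
    have "rev p1 = rev q1"
      using path_continuation_unique_last[OF E, of y x "rev p1" "rev q1"] P Q 1 ends by simp
    moreover have "p2 = q2"
      using path_continuation_unique_last[OF E, of x y p2 q2] P Q 1 ends pp qq by simp
    ultimately show ?thesis using pp qq 1 by simp
  next
    case 2
    \<comment> \<open>The backward part of \<open>p\<close> and the forward part of \<open>q\<close>
      both start with the directed edge from \<open>y\<close> to \<open>x\<close>, so one is a
      prefix of the other.\<close>
    then consider r where "rev p1 = q2 @ r" | r where "q2 = rev p1 @ r"
      using path_continuation_unique[OF E, of y x "rev p1" q2] P Q by auto
    then show ?thesis
    proof cases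
      case 1
      have "last q \<in> set (x # q2)" using qq 2 by auto
      then have "last q \<in> set (x # p1)" using arg_cong[OF 1, of set] by auto
      moreover have "last p \<in> set (y # p2)" using pp by auto
      ultimately show ?thesis using ends p(3) pp by auto
    next
      case r: 2
      have "hd p \<in> set (x # p1)" using pp by (cases p1) auto
      then have "hd p \<in> set (x # q2)" using r by auto
      moreover have "hd q \<in> set (q1 @ [y])" using qq 2 by (cases q1) auto
      ultimately show ?thesis using ends q(3) qq 2 by auto
    qed
  qed
qed

section \<open>Cycles from distinct paths, and uniqueness of paths in trees\<close>

text \<open>Common initial vertices are stripped by induction. From the branching vertex, one path
  is followed until it first meets the other, which is then followed back.\<close>

lemma two_paths_cycle:
  assumes "p \<noteq> []" "q \<noteq> []" "distinct p" "distinct q" "hd p = hd q" "last p = last q" "p \<noteq> q"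
  shows "\<exists>c. distinct c \<and> 3 \<le> length c \<and> set c \<subseteq> set p \<union> set q
    \<and> cycle_edges c \<subseteq> path_edges p \<union> path_edges q"
  using assms
proof (induction p arbitrary: q)
  case (Cons x p')
  obtain q' where q: "q = x # q'" using Cons.prems by (cases q) auto
  have p'0: "p' \<noteq> []"
    using Cons.prems q by (metis distinct.simps(2) last_ConsL last_ConsR last_in_set)
  have q'0: "q' \<noteq> []"
    using Cons.prems q by (metis distinct.simps(2) last_ConsL last_ConsR last_in_set)
  show ?case
  proof (cases "hd p' = hd q'")
    case True
    then obtain c where "distinct c" "3 \<le> length c" "set c \<subseteq> set p' \<union> set q'"
      "cycle_edges c \<subseteq> path_edges p' \<union> path_edges q'"
      using Cons.IH[of q'] Cons.prems q p'0 q'0 by auto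
    then show ?thesis using q p'0 q'0 by (intro exI[of _ c]) (auto simp: path_edges_Cons)
  next
    case False
    \<comment> \<open>The common end vertex guarantees that the paths meet again. Taking
      \<open>y\<close> as the first vertex of \<open>p'\<close> on \<open>q'\<close> makes
      \<open>p1\<close> disjoint from \<open>q1\<close>.\<close>
    have "last p' \<in> set p' \<and> last p' \<in> set q'"
      using Cons.prems q p'0 q'0 by (metis last_ConsR last_in_set)
    then obtain p1 y p2 where p': "p' = p1 @ y # p2" "y \<in> set q'" "\<forall>z \<in> set p1. z \<notin> set q'"
      using split_list_first_prop[of p' "\<lambda>z. z \<in> set q'"] by blast
    obtain q1 q2 where q': "q' = q1 @ y # q2"
      using p'(2) by (meson split_list)
    define c where "c = x # p1 @ y # rev q1"
    \<comment> \<open>If both were empty, \<open>y\<close> would be the head of both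
      \<open>p'\<close> and \<open>q'\<close>; so the closed walk has at least three
      vertices.\<close>
    have "p1 \<noteq> [] \<or> q1 \<noteq> []" using False p' q' by auto
    then have "3 \<le> length c" unfolding c_def by (cases p1; cases q1) auto
    moreover have "distinct c" "set c \<subseteq> set (x # p') \<union> set q"
      using Cons.prems p' q' q unfolding c_def by auto
    moreover have "cycle_edges c \<subseteq> path_edges (x # p') \<union> path_edges q"
      using path_edges_rev[of q1] unfolding c_def q p' q' cycle_edges_def
      by (cases q1) (auto simp: path_edges_Cons path_edges_append hd_rev last_rev hd_append
          insert_commute split: if_splits)
    ultimately show ?thesis by blast
  qed
qed auto

text \<open>Supplies the simplicity that \<open>subgraph\<close> demands: the closing edge has two
  distinct ends because the list is long enough and free of repetitions.\<close>

lemma simple_graph_cycle: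
  assumes "distinct p" "3 \<le> length p"
  shows "simple_graph \<lparr>verts = set p, edges = cycle_edges p\<rparr>"
proof -
  have path: "card e = 2" if "e \<in> path_edges p"
    for e using path_edges_split[OF that] assms(1) by auto
  obtain x y r where "p = x # y # r"
    using assms(2) by (cases p; cases "tl p") auto
  then have "last p \<noteq> hd p" using assms(1) by (cases r rule: rev_cases) auto
  then have "card {last p, hd p} = 2" by simp
  then have "card e = 2" if "e \<in> cycle_edges p" for e
    using path that by (auto simp: cycle_edges_def)
  moreover have "p \<noteq> []" using assms(2) by auto
  ultimately show ?thesis
    using cycle_edges_subset[of p] unfolding simple_graph_def by auto
qed

lemma tree_path_unique:
  assumes "is_tree G" "p \<in> paths G u v" "q \<in> paths G u v"
  shows "p = q"
proof (rule ccontr)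
  assume "p \<noteq> q"
  then obtain c where c: "distinct c" "3 \<le> length c" "set c \<subseteq> set p \<union> set q"
    "cycle_edges c \<subseteq> path_edges p \<union> path_edges q"
    using two_paths_cycle[of p q] assms(2,3) unfolding paths_def by auto
  let ?C = "\<lparr>verts = set c, edges = cycle_edges c\<rparr>"
  have "subgraph ?C G"
    using simple_graph_cycle[OF c(1,2)] c(3,4) assms(2,3)
    unfolding subgraph_def paths_def by auto
  moreover have "is_cycle ?C"
    unfolding is_cycle_def using c(1,2) by (auto simp: cycle_edges_def)
  ultimately show False using assms(1) unfolding is_tree_def by blast
qed

lemma is_cycle_iff:
  "is_cycle G \<longleftrightarrow>
     (\<exists>p. distinct p \<and> 3 \<le> length p \<and> verts G = set p \<and> edges G = cycle_edges p)"
  unfolding is_cycle_def cycle_edges_def ..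

text \<open>After rotating \<open>v\<close> to the front, its successor and the last vertex are
  distinct since the length is at least three.\<close>

lemma cycle_two_neighbours:
  assumes "is_cycle C" "v \<in> verts C"
  obtains a b where "a \<noteq> b" "{v, a} \<in> edges C" "{v, b} \<in> edges C"
proof -
  obtain p where p: "distinct p" "3 \<le> length p" "verts C = set p" "edges C = cycle_edges p"
    using assms(1) unfolding is_cycle_iff by auto
  obtain r where r: "distinct (v # r)" "length (v # r) = length p"
    "cycle_edges (v # r) = cycle_edges p"
    using rotate_to_head[of v p] assms(2) p by metis
  obtain a b s where s: "r = a # b # s"
    using r(2) p(2) by (cases r; cases "tl r") auto
  have "a \<noteq> last (b # s)" using r(1) s by (metis distinct.simps(2) last_in_set list.distinct(1))
  moreover have "{v, a} \<in> edges C" "{v, last (b # s)} \<in> edges C"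
    unfolding p(4) r(3)[symmetric] s by (auto simp: cycle_edges_def insert_commute)
  ultimately show ?thesis using that by blast
qed

section \<open>Stars and choke points\<close>

text \<open>Acyclicity is the main point: a cycle has a vertex other than \<open>c\<close>, with two
  neighbours on the cycle, whereas in the star its only neighbour is \<open>c\<close>.\<close>

lemma is_star_3:
  assumes "distinct [c, x, y, z]"
  shows "is_star 3 c \<lparr>verts = {c, x, y, z}, edges = {{c, x}, {c, y}, {c, z}}\<rparr>"
    (is "is_star 3 c ?S")
proof -
  have simple: "simple_graph ?S" using assms unfolding simple_graph_def by auto
  have "paths ?S u v \<noteq> {}" if uv: "u \<in> verts ?S" "v \<in> verts ?S" for u v
  proof -
    have "(if u = v then [u] else if u = c \<or> v = c then [u, v] else [u, c, v]) \<in> paths ?S u v"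
      using uv assms unfolding paths_def by (auto simp: insert_commute)
    then show ?thesis by blast
  qed
  then have connected: "connected_graph ?S" unfolding connected_graph_def by auto
  have "\<not> is_cycle C" if C: "subgraph C ?S" for C
  proof
    assume cyc: "is_cycle C"
    then obtain p where p: "distinct p" "3 \<le> length p" "verts C = set p"
      unfolding is_cycle_iff by auto
    then have "\<not> verts C \<subseteq> {c}"
      using card_mono[of "{c}" "set p"] distinct_card[of p] by auto
    then obtain v where v: "v \<in> verts C" "v \<noteq> c" by auto
    then obtain a b where "a \<noteq> b" "{v, a} \<in> edges C" "{v, b} \<in> edges C"
      using cycle_two_neighbours[OF cyc] by metis
    then have "a \<noteq> b" "{v, a} \<in> edges ?S" "{v, b} \<in> edges ?S"
      using C unfolding subgraph_def by auto
    then show False using v(2) by (auto simp: doubleton_eq_iff)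
  qed
  then show ?thesis
    using simple connected assms unfolding is_star_def is_tree_def by auto
qed

text \<open>Three leaves of a star with \<open>3 \<le> k\<close> already violate the degree bound;
  conversely three distinct neighbours give the star of \<open>is_star_3\<close>. Simplicity of
  \<open>G\<close> excludes an edge \<open>{c}\<close>, so \<open>c\<close> is not its own
  neighbour.\<close>

lemma has_choke_point_iff:
  assumes "simple_graph G"
  shows "has_choke_point G \<longleftrightarrow>
    (\<exists>u \<in> verts G. \<exists>v \<in> verts G. \<not> degree_le_2 (edges (paths_union G u v)))"
proof -
  have "(\<exists>c. choke_point G u v c) \<longleftrightarrow> \<not> degree_le_2 (edges (paths_union G u v))" for u v
  proof
    assume "\<exists>c. choke_point G u v c"
    then obtain c k S where S: "3 \<le> k" "is_star k c S" "subgraph S (paths_union G u v)"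
      unfolding choke_point_def by blast
    \<comment> \<open>Infinite sets have \<open>card\<close> equal to 0, but here it is
      \<open>k + 1\<close>.\<close>
    have "finite (verts S)" using S(2) unfolding is_star_def by (auto intro: card_ge_0_finite)
    then have "3 \<le> card (verts S - {c})" using S unfolding is_star_def by auto
    then obtain T where T: "T \<subseteq> verts S - {c}" "card T = 3"
      by (meson obtain_subset_with_card_n)
    then obtain x y z where xyz: "T = {x, y, z}" "x \<noteq> y" "y \<noteq> z" "x \<noteq> z"
      unfolding card_3_iff by blast
    have "{c, w} \<in> edges (paths_union G u v)" if "w \<in> T" for w
      using that T S unfolding is_star_def subgraph_def by auto
    then show "\<not> degree_le_2 (edges (paths_union G u v))"
      using xyz unfolding degree_le_2_def by blast
  next
    assume "\<not> degree_le_2 (edges (paths_union G u v))"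
    then obtain c x y z where E: "{c, x} \<in> edges (paths_union G u v)"
      "{c, y} \<in> edges (paths_union G u v)" "{c, z} \<in> edges (paths_union G u v)"
      and d: "x \<noteq> y" "x \<noteq> z" "y \<noteq> z"
      unfolding degree_le_2_def by blast
    have sub: "c \<noteq> w \<and> {c, w} \<subseteq> verts (paths_union G u v)"
      if w: "{c, w} \<in> edges (paths_union G u v)" for w
    proof -
      obtain p where p: "p \<in> paths G u v" "{c, w} \<in> path_edges p"
        using w unfolding paths_union_def path_graph_def by auto
      then have "card {c, w} = 2"
        using assms unfolding simple_graph_def paths_def by blast
      then show ?thesis
        using p path_edges_subset[OF p(2)] unfolding paths_union_def path_graph_def
        by (auto simp: card_insert_if split: if_splits)
    qed
    have "distinct [c, x, y, z]" using sub E d by auto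
    note star = is_star_3[OF this]
    have "subgraph \<lparr>verts = {c, x, y, z}, edges = {{c, x}, {c, y}, {c, z}}\<rparr> (paths_union G u v)"
      using star E sub[OF E(1)] sub[OF E(2)] sub[OF E(3)]
      unfolding is_star_def is_tree_def subgraph_def by auto
    then show "\<exists>c. choke_point G u v c"
      unfolding choke_point_def using star by blast
  qed
  then show ?thesis unfolding has_choke_point_def by blast
qed

section \<open>Trees and cycles have both properties\<close>

lemma tree_or_cycle_no_choke_point:
  assumes "simple_graph G" "is_tree G \<or> is_cycle G"
  shows "\<not> has_choke_point G"
proof -
  have "degree_le_2 (edges (paths_union G u v))" for u v
    using assms(2)
  proof
    assume tree: "is_tree G"
    show ?thesis
    proof (cases "paths G u v = {}")
      case True
      then show ?thesis unfolding paths_union_def degree_le_2_def by simp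
    next
      case False
      then obtain p where p: "paths G u v = {p}"
        using tree_path_unique[OF tree] by blast
      then have "distinct p" unfolding paths_def by blast
      then show ?thesis
        using degree_le_2_path_edges p unfolding paths_union_def path_graph_def by simp
    qed
  next
    assume "is_cycle G"
    then have "degree_le_2 (edges G)"
      unfolding is_cycle_iff using degree_le_2_cycle_edges by fastforce
    then show ?thesis
      by (rule degree_le_2_mono) (auto simp: paths_union_def path_graph_def paths_def)
  qed
  then show ?thesis using has_choke_point_iff[OF assms(1)] by blast
qed

lemma tree_or_cycle_edge_disjoint:
  assumes "is_tree G \<or> is_cycle G"
  shows "edge_disjoint_path_property G"
  using assms
proof
  assume "is_tree G"
  then show ?thesis
    using tree_path_unique unfolding edge_disjoint_path_property_def by metis
next
  assume "is_cycle G"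
  then have "degree_le_2 (edges G)"
    unfolding is_cycle_iff using degree_le_2_cycle_edges by fastforce
  \<comment> \<open>In a cycle, sharing a single edge already forces two paths with the same ends to
    coincide.\<close>
  then have "p = q" if "p \<in> paths G u v" "q \<in> paths G u v" "e \<in> path_edges p" "e \<in> path_edges q"
    for p q u v e
    using degree_le_2_edge_disjoint[of "edges G" p q e] that unfolding paths_def by auto
  then show ?thesis
    unfolding edge_disjoint_path_property_def path_graph_def by fastforce
qed

section \<open>Graphs that are neither trees nor cycles\<close>

lemma path_leaves_set:
  assumes "p \<noteq> []" "hd p \<in> A" "last p \<notin> A"
  shows "\<exists>x \<in> A. \<exists>y. y \<notin> A \<and> {x, y} \<in> path_edges p"
  using assms
proof (induction p rule: path_edges.induct)
  case (3 x y xs)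
  then show ?case by (cases "y \<in> A") auto
qed auto

text \<open>If the cycle spans \<open>G\<close>, an edge outside it is a chord, which exists as
  \<open>G\<close> is not a cycle; otherwise connectedness yields an edge leaving the cycle.
  Rotation puts the end \<open>c\<close> of that edge first.\<close>

lemma cycle_with_extra_edge:
  assumes "simple_graph G" "connected_graph G" "\<not> is_tree G" "\<not> is_cycle G"
  obtains c r w where "distinct (c # r)" "2 \<le> length r" "set (c # r) \<subseteq> verts G"
    "cycle_edges (c # r) \<subseteq> edges G" "{c, w} \<in> edges G" "{c, w} \<notin> cycle_edges (c # r)"
proof -
  obtain C where C: "subgraph C G" "is_cycle C" using assms unfolding is_tree_def by blast
  then obtain p where p: "distinct p" "3 \<le> length p" "set p \<subseteq> verts G" "cycle_edges p \<subseteq> edges G"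
    unfolding is_cycle_iff subgraph_def by auto
  have "\<exists>c w. c \<in> set p \<and> {c, w} \<in> edges G \<and> {c, w} \<notin> cycle_edges p"
  proof (cases "set p = verts G")
    case True
    then obtain e where e: "e \<in> edges G" "e \<notin> cycle_edges p"
      using assms(4) p unfolding is_cycle_iff by blast
    then have "card e = 2" "e \<subseteq> set p" using assms(1) True unfolding simple_graph_def by auto
    then obtain c w where "e = {c, w}" "c \<in> set p" unfolding card_2_iff by auto
    then show ?thesis using e by blast
  next
    case False
    then obtain z where z: "z \<in> verts G" "z \<notin> set p" using p(3) by blast
    have h: "hd p \<in> set p" using p(2) by (cases p) auto
    then obtain q where q: "q \<in> paths G (hd p) z"
      using assms(2) p(3) z(1) unfolding connected_graph_def by blast
    then obtain c w where "c \<in> set p" "w \<notin> set p" "{c, w} \<in> path_edges q"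
      using path_leaves_set[of q "set p"] h z unfolding paths_def by auto
    moreover have "{c, w} \<notin> cycle_edges p"
      using cycle_edges_subset[of p "{c, w}"] calculation by (cases "p = []") auto
    ultimately show ?thesis using q unfolding paths_def by blast
  qed
  then obtain c w where cw: "c \<in> set p" "{c, w} \<in> edges G" "{c, w} \<notin> cycle_edges p" by blast
  obtain r where r: "distinct (c # r)" "set (c # r) = set p" "length (c # r) = length p"
    "cycle_edges (c # r) = cycle_edges p"
    by (rule rotate_to_head[OF cw(1) p(1)])
  have "2 \<le> length r" using r(3) p(2) by simp
  then show ?thesis using that[of c r w] r cw p by metis
qed

text \<open>The vertex \<open>c\<close> has three distinct neighbours \<open>w\<close>,
  \<open>hd r\<close> and \<open>last r\<close>; the end vertices are chosen so that paths between
  them use all three edges at \<open>c\<close>.\<close>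

lemma no_tree_no_cycle:
  assumes G: "simple_graph G" "connected_graph G" "\<not> is_tree G" "\<not> is_cycle G"
  shows "has_choke_point G \<and> \<not> edge_disjoint_path_property G"
proof -
  obtain c r w where r: "distinct (c # r)" "2 \<le> length r" "set (c # r) \<subseteq> verts G"
    "cycle_edges (c # r) \<subseteq> edges G" "{c, w} \<in> edges G" "{c, w} \<notin> cycle_edges (c # r)"
    by (rule cycle_with_extra_edge[OF G])
  have w: "w \<in> verts G" "w \<noteq> c" using r(5) G(1) unfolding simple_graph_def by fastforce+
  have r0: "r \<noteq> []" using r(2) by auto
  have rE: "path_edges r \<subseteq> edges G" "{c, hd r} \<in> edges G" "{c, last r} \<in> edges G"
    using r(4) r0 by (auto simp: cycle_edges_def path_edges_Cons insert_commute)
  have hl: "hd r \<noteq> last r" using r(1,2) by (cases r) auto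
  have wn: "w \<noteq> hd r" "w \<noteq> last r"
    using r(6) r0 by (auto simp: cycle_edges_def path_edges_Cons insert_commute)
  have choke: "has_choke_point G" if "u \<in> verts G" "v \<in> verts G"
    "P \<in> paths G u v" "{c, w} \<in> path_edges P"
    "Q \<in> paths G u v" "{c, hd r} \<in> path_edges Q"
    "R \<in> paths G u v" "{c, last r} \<in> path_edges R" for u v P Q R
  proof -
    have "{c, w} \<in> edges (paths_union G u v)" "{c, hd r} \<in> edges (paths_union G u v)"
      "{c, last r} \<in> edges (paths_union G u v)"
      using that unfolding paths_union_def path_graph_def by auto
    then have "\<not> degree_le_2 (edges (paths_union G u v))"
      using wn hl unfolding degree_le_2_def by blast
    then show ?thesis using has_choke_point_iff[OF G(1)] that(1,2) by blast
  qed
  have shared: "\<not> edge_disjoint_path_property G" if "u \<in> verts G" "v \<in> verts G" "u \<noteq> v"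
    "P \<in> paths G u v" "Q \<in> paths G u v" "P \<noteq> Q" "e \<in> path_edges P" "e \<in> path_edges Q" for u v P Q e
    using that unfolding edge_disjoint_path_property_def path_graph_def by fastforce
  have lV: "hd r \<in> verts G" "last r \<in> verts G" "c \<in> verts G" using r(3) r0 by auto
  show ?thesis
  proof (cases "w \<in> set r")
    case False
    \<comment> \<open>After the common edge from \<open>w\<close> to \<open>c\<close>, the two arcs
      of the cycle from \<open>c\<close> to \<open>last r\<close> are used: its closing edge and all
      of \<open>r\<close>. Here \<open>P\<close> covers two of the three edges at
      \<open>c\<close>.\<close>
    have P: "[w, c, last r] \<in> paths G w (last r)"
      using w lV r(1,5) rE wn r0 unfolding paths_def by (auto simp: insert_commute)
    have Q: "w # c # r \<in> paths G w (last r)"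
      using False w r(1,3,5) rE r0 unfolding paths_def
      by (auto simp: path_edges_Cons insert_commute)
    have "has_choke_point G"
      by (rule choke[OF w(1) lV(2) P _ Q _ P]) (use r0 in \<open>auto simp: path_edges_Cons insert_commute\<close>)
    moreover have "\<not> edge_disjoint_path_property G"
      by (rule shared[OF w(1) lV(2) wn(2) P Q, of "{w, c}"]) (use r(2) in \<open>cases r; auto\<close>)+
    ultimately show ?thesis ..
  next
    case True
    then obtain s t where st: "r = s @ w # t" by (meson split_list)
    have s0: "s \<noteq> []" and t0: "t \<noteq> []" using wn st by auto
    have sE: "path_edges s \<subseteq> edges G" "path_edges t \<subseteq> edges G" "{last s, w} \<in> edges G"
      "{w, hd t} \<in> edges G"
      using rE(1) s0 t0 unfolding st by (auto simp: path_edges_append path_edges_Cons)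
    have hs: "hd r = hd s" "last r = last t" using st s0 t0 by auto
    have inS: "hd s \<in> set s" using s0 by auto
    \<comment> \<open>The chord and the two arcs of the cycle give three paths from \<open>c\<close>
      to \<open>w\<close>, each starting with a different edge at \<open>c\<close>.\<close>
    have P: "[c, w] \<in> paths G c w" using w lV r(5) unfolding paths_def by auto
    have Q: "c # s @ [w] \<in> paths G c w"
      using r(1,3) w sE s0 rE hs unfolding paths_def st
      by (auto simp: path_edges_append path_edges_Cons)
    have R: "c # rev t @ [w] \<in> paths G c w"
      using r(1,3) w sE t0 rE hs unfolding paths_def st
      by (auto simp: path_edges_append path_edges_Cons path_edges_rev hd_rev last_rev insert_commute)
    have "has_choke_point G"
      by (rule choke[OF lV(3) w(1) P _ Q _ R])
        (use s0 t0 hs in \<open>auto simp: path_edges_Cons hd_rev\<close>)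
    moreover have "\<not> edge_disjoint_path_property G"
    \<comment> \<open>The three paths from \<open>c\<close> to \<open>w\<close> are pairwise
      edge-disjoint, so the start moves to \<open>hd s\<close>: the chord and the arc through
      \<open>t\<close> avoid this vertex and can both be preceded by the edge
      \<open>{hd s, c}\<close>.\<close>
    proof (rule shared[OF lV(1) w(1) wn(1)[symmetric],
          of "hd s # [c, w]" "hd s # c # rev t @ [w]" "{hd s, c}"])
      show "hd s # [c, w] \<in> paths G (hd r) w"
        using P lV rE hs wn r(1) inS st unfolding paths_def by (auto simp: insert_commute)
      have "hd s \<notin> set (c # rev t @ [w])" using inS r(1) st by auto
      then show "hd s # c # rev t @ [w] \<in> paths G (hd r) w"
        using R lV rE hs unfolding paths_def by (auto simp: insert_commute)
    qed (use t0 in auto)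
    ultimately show ?thesis ..
  qed
qed

theorem theorem4p6:
  fixes G :: "'a ugraph"
  assumes "simple_graph G" and "connected_graph G"
  shows "(\<not> has_choke_point G \<longleftrightarrow> edge_disjoint_path_property G)
       \<and> (edge_disjoint_path_property G \<longleftrightarrow> is_tree G \<or> is_cycle G)"
  using no_tree_no_cycle[OF assms] tree_or_cycle_no_choke_point[OF assms(1)]
    tree_or_cycle_edge_disjoint[of G] by blast

end
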